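(* For any $\varepsilon\in(0,1/2)$ there exists a family of Markov kernels $P_{\delta,N}$, parameterized by $\delta\in(0,1)$ and integers $N\ge1$, each on a finite state space (which may depend on the parameters) and reversible with respect to a stationary distribution of full support, such that, writing $M_{\delta,N}:=M(P_{\delta,N})$, $$\lim_{N\to\infty}\lim_{\delta\to0}L(P_{\delta,N})\le 2\varepsilon,\qquad \lim_{N\to\infty}\lim_{\delta\to0}\frac{\eta_{\mathrm{KL}}(P_{\delta,N})}{M_{\delta,N}}\ge 2.$$ Consequently, $L(P)\to0$ does not universally imply $\eta_{\mathrm{KL}}(P)/M(P)\to1$; that is, there is a sequence of such chains $(P_n)$ with $L(P_n)\to0$ for which $\eta_{\mathrm{KL}}(P_n)/M(P_n)$ does not converge to $1$.
   Context: All logarithms are natural, with $0\log0=0$. Let $P$ be a Markov kernel on a finite state space $S$, $|S|\ge2$, with stationary distribution $\pi$ of full support; $P$ is reversible w.r.t. $\pi$ if $\pi(x)P(x,y)=\pi(y)P(y,x)$ for all $x,y$. $D_{\mathrm{KL}}(\mu\|\nu)=\sum_{x}\mu(x)\log\frac{\mu(x)}{\nu(x)}$. Relative to $\pi$ define: - the KL contraction coefficient $\eta_{\mathrm{KL}}(P):=\sup_{\mu\ne\pi}D_{\mathrm{KL}}(\mu P\|\pi)/D_{\mathrm{KL}}(\mu\|\pi)$, the supremum being over all probability distributions $\mu\neq\pi$ on $S$; - the local retention ratio $r(x):=D_{\mathrm{KL}}(P(x,\cdot)\|\pi)/\log(1/\pi(x))$; - $M(P):=\max_{x\in S}r(x)$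 and $\bar r_\pi:=\sum_{x\in S}\pi(x)r(x)$; - the localization ratio $L(P):=\bar r_\pi/M(P)$, with the convention $L(P)=1$ when $\bar r_\pi=M(P)=0$. *)

theory Defs
  imports "HOL-Probability.Probability"
begin

text \<open>
  State spaces are finite carrier sets \<open>S\<close>. A kernel is a function \<open>P\<close> giving the row
  \<open>P x\<close> as a probability mass function; rows are only constrained at states in \<open>S\<close>.
  A distribution on \<open>S\<close> is a mass function supported in \<open>S\<close>.
\<close>

definition dists_on :: "'a set \<Rightarrow> 'a pmf set" where
  "dists_on S = {\<mu>. set_pmf \<mu> \<subseteq> S}"

definition markov_kernel :: "'a set \<Rightarrow> ('a \<Rightarrow> 'a pmf) \<Rightarrow> bool" where
  "markov_kernel S P \<longleftrightarrow> finite S \<and> card S \<ge> 2 \<and> (\<forall>x\<in>S. P x \<in> dists_on S)"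

definition stationary :: "('a \<Rightarrow> 'a pmf) \<Rightarrow> 'a pmf \<Rightarrow> bool" where
  "stationary P \<pi> \<longleftrightarrow> bind_pmf \<pi> P = \<pi>"

definition reversible :: "'a set \<Rightarrow> ('a \<Rightarrow> 'a pmf) \<Rightarrow> 'a pmf \<Rightarrow> bool" where
  "reversible S P \<pi> \<longleftrightarrow>
     (\<forall>x\<in>S. \<forall>y\<in>S. pmf \<pi> x * pmf (P x) y = pmf \<pi> y * pmf (P y) x)"

text \<open>The condition \<^term>\<open>set_pmf \<pi> = S\<close> says that \<open>\<pi>\<close> lives on \<open>S\<close> with full support.\<close>

definition reversible_chain :: "'a set \<Rightarrow> ('a \<Rightarrow> 'a pmf) \<Rightarrow> 'a pmf \<Rightarrow> bool" where
  "reversible_chain S P \<pi> \<longleftrightarrow>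
     markov_kernel S P \<and> set_pmf \<pi> = S \<and> stationary P \<pi> \<and> reversible S P \<pi>"

text \<open>The convention \<open>0 log 0 = 0\<close> holds automatically, since the logarithm is multiplied by 0.\<close>

definition KL_div :: "'a set \<Rightarrow> 'a pmf \<Rightarrow> 'a pmf \<Rightarrow> real" where
  "KL_div S \<mu> \<nu> = (\<Sum>x\<in>S. pmf \<mu> x * ln (pmf \<mu> x / pmf \<nu> x))"

text \<open>
  Agreement with the library's divergence, whose arguments come in the opposite order.
\<close>

lemma KL_div_eq_KL_divergence:
  assumes "finite S" "set_pmf \<mu> \<subseteq> S" "set_pmf \<nu> = S"
  shows "KL_div S \<mu> \<nu> = KL_divergence (exp 1) (measure_pmf \<nu>) (measure_pmf \<mu>)"
proof -
  define f where "f = (\<lambda>x. pmf \<mu> x / pmf \<nu> x)"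
  have pos: "pmf \<nu> x > 0" if "x \<in> S" for x
    using that assms(3) by (simp add: pmf_positive)
  have zero: "pmf \<mu> x = 0" if "x \<notin> S" for x
    using that assms(2) by (auto simp: set_pmf_iff)
  have fnu: "pmf \<nu> x * f x = pmf \<mu> x" for x
    using pos[of x] zero[of x] by (cases "x \<in> S") (auto simp: f_def)
  have "measure_pmf \<mu> = density (measure_pmf \<nu>) (\<lambda>x. ennreal (f x))"
  proof (rule measure_eqI)
    fix A assume "A \<in> sets (measure_pmf \<mu>)"
    have "emeasure (density (measure_pmf \<nu>) (\<lambda>x. ennreal (f x))) A
        = (\<integral>\<^sup>+x. ennreal (pmf \<nu> x) * (ennreal (f x) * indicator A x) \<partial>count_space UNIV)"
      by (simp add: emeasure_density nn_integral_measure_pmf)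
    also have "\<dots> = (\<integral>\<^sup>+x. ennreal (pmf \<mu> x) * indicator A x \<partial>count_space UNIV)"
      by (intro nn_integral_cong)
        (metis ennreal_mult' fnu mult.assoc pmf_nonneg)
    also have "\<dots> = emeasure (measure_pmf \<mu>) A"
      by (simp add: nn_integral_measure_pmf [symmetric])
    finally show "emeasure (measure_pmf \<mu>) A
        = emeasure (density (measure_pmf \<nu>) (\<lambda>x. ennreal (f x))) A" by simp
  qed simp
  then have "KL_divergence (exp 1) (measure_pmf \<nu>) (measure_pmf \<mu>)
      = (\<integral>x. f x * log (exp 1) (f x) \<partial>measure_pmf \<nu>)"
    using sigma_finite_measure.KL_density[of "measure_pmf \<nu>" "exp 1" f]
    by (simp add: f_def measure_pmf.sigma_finite_measure_axioms)
  also have "\<dots> = (\<Sum>x\<in>S. pmf \<nu> x * (f x * ln (f x)))"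
    using assms(1,3) by (subst integral_measure_pmf[of S]) (auto simp: log_def)
  also have "\<dots> = KL_div S \<mu> \<nu>"
    unfolding KL_div_def by (simp only: mult.assoc[symmetric] fnu) (simp only: f_def)
  finally show ?thesis ..
qed

text \<open>
  \<^term>\<open>bind_pmf \<mu> P\<close> is \<open>\<mu>P\<close>. The supremum is over a nonempty set bounded by 1 (data processing)
  whenever \<open>P\<close> is a Markov kernel with stationary distribution \<open>\<pi>\<close> of full support.
\<close>

definition eta_KL :: "'a set \<Rightarrow> ('a \<Rightarrow> 'a pmf) \<Rightarrow> 'a pmf \<Rightarrow> real" where
  "eta_KL S P \<pi> =
     (SUP \<mu> \<in> dists_on S - {\<pi>}. KL_div S (bind_pmf \<mu> P) \<pi> / KL_div S \<mu> \<pi>)"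

definition retention :: "'a set \<Rightarrow> ('a \<Rightarrow> 'a pmf) \<Rightarrow> 'a pmf \<Rightarrow> 'a \<Rightarrow> real" where
  "retention S P \<pi> x = KL_div S (P x) \<pi> / ln (1 / pmf \<pi> x)"

definition max_retention :: "'a set \<Rightarrow> ('a \<Rightarrow> 'a pmf) \<Rightarrow> 'a pmf \<Rightarrow> real" where
  "max_retention S P \<pi> = Max (retention S P \<pi> ` S)"

definition mean_retention :: "'a set \<Rightarrow> ('a \<Rightarrow> 'a pmf) \<Rightarrow> 'a pmf \<Rightarrow> real" where
  "mean_retention S P \<pi> = (\<Sum>x\<in>S. pmf \<pi> x * retention S P \<pi> x)"

definition localization_ratio :: "'a set \<Rightarrow> ('a \<Rightarrow> 'a pmf) \<Rightarrow> 'a pmf \<Rightarrow> real" where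
  "localization_ratio S P \<pi> =
     (if mean_retention S P \<pi> = 0 \<and> max_retention S P \<pi> = 0 then 1
      else mean_retention S P \<pi> / max_retention S P \<pi>)"

text \<open>
  The iterated limit of \<open>f \<delta> N\<close>, first \<open>\<delta> \<rightarrow> 0\<close> from the right, then \<open>N \<rightarrow> \<infinity>\<close>, exists and
  equals \<open>l\<close>; the inner limits are required to exist for every \<open>N \<ge> 1\<close>.
\<close>

definition has_iterated_limit :: "(real \<Rightarrow> nat \<Rightarrow> real) \<Rightarrow> real \<Rightarrow> bool" where
  "has_iterated_limit f l \<longleftrightarrow>
     (\<exists>g. (\<forall>N\<ge>1. ((\<lambda>\<delta>. f \<delta> N) \<longlongrightarrow> g N) (at_right 0)) \<and> g \<longlonglongrightarrow> l)"

end

theory Submission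
  imports Defs "HOL-Real_Asymp.Real_Asymp"
begin

text \<open>
  Let \<open>\<pi>\<close> be uniform on \<open>n\<^sup>2\<close> states, split into a small block of \<open>n\<close> states and its complement,
  and let one step resample uniformly inside the current block. A point mass in the small block has
  divergence \<open>2 ln n\<close> and is mapped to divergence \<open>ln n\<close>, so it retains one half; points of the
  large block, which carries all but \<open>1/n\<close> of the mass, retain almost nothing. Hence \<open>M = 1/2\<close> and
  \<open>L \<rightarrow> 0\<close>. The uniform distribution on the small block is invariant, so \<open>\<eta>\<^sub>K\<^sub>L = 1\<close> by
  data processing, and \<open>\<eta>\<^sub>K\<^sub>L / M = 2\<close> for every \<open>n\<close>. The blocks need not communicate, so no
  perturbation is needed and the family is constant in \<open>\<delta>\<close>.
\<close>

section \<open>Log-sum inequality and data processing\<close>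

text \<open>The bound ln t \<le> t - 1, used termwise, yields the claim after summation. As a / 0 =
  0 in HOL, a term with b_i = 0 < a_i would not be infinite; \<open>ab\<close> excludes such
  terms.\<close>

lemma log_sum_inequality:
  fixes a b :: "'i \<Rightarrow> real"
  assumes "finite I" and a: "\<And>i. i \<in> I \<Longrightarrow> 0 \<le> a i" and b: "\<And>i. i \<in> I \<Longrightarrow> 0 \<le> b i"
    and ab: "\<And>i. i \<in> I \<Longrightarrow> b i = 0 \<Longrightarrow> a i = 0"
  shows "sum a I * ln (sum a I / sum b I) \<le> (\<Sum>i\<in>I. a i * ln (a i / b i))"
proof (cases "sum a I = 0")
  case True
  then have "\<forall>i\<in>I. a i = 0"
    using a \<open>finite I\<close> by (simp add: sum_nonneg_eq_0_iff)
  then show ?thesis by simp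
next
  case False
  \<comment> \<open>Scaling \<open>b\<close> by this ratio gives it the total mass of
    \<open>a\<close>, so the linear terms \<open>a i - c * b i\<close> below sum to 0.\<close>
  define c where "c = sum a I / sum b I"
  have apos: "0 < sum a I"
    using False a by (simp add: less_le sum_nonneg)
  have "sum b I \<noteq> 0"
  proof
    assume "sum b I = 0"
    then have "\<forall>i\<in>I. b i = 0"
      using b \<open>finite I\<close> by (simp add: sum_nonneg_eq_0_iff)
    then show False using ab False by simp
  qed
  then have bpos: "0 < sum b I"
    using b by (simp add: less_le sum_nonneg)
  have c: "0 < c" "c * sum b I = sum a I"
    using apos bpos by (simp_all add: c_def)
  have "a i - c * b i \<le> a i * ln (a i / b i) - a i * ln c" if i: "i \<in> I" for i
  proof (cases "a i = 0")
    case True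
    then show ?thesis using b[OF i] c by simp
  next
    case False
    then have pos: "0 < a i" "0 < b i"
      using a[OF i] b[OF i] ab[OF i] by (auto simp: less_le)
    have "ln (c * b i / a i) \<le> c * b i / a i - 1"
      using pos c by (intro ln_le_minus_one) simp
    then have "a i * ln (c * b i / a i) \<le> a i * (c * b i / a i - 1)"
      using pos by (intro mult_left_mono) auto
    also have "\<dots> = c * b i - a i"
      using pos by (simp add: field_simps)
    finally have "a i - c * b i \<le> - (a i * ln (c * b i / a i))" by simp
    also have "\<dots> = a i * ln (a i / b i) - a i * ln c"
      using pos c by (simp add: ln_div ln_mult algebra_simps)
    finally show ?thesis .
  qed
  then have "(\<Sum>i\<in>I. a i - c * b i) \<le> (\<Sum>i\<in>I. a i * ln (a i / b i) - a i * ln c)"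
    by (rule sum_mono)
  then have "sum a I - c * sum b I \<le> (\<Sum>i\<in>I. a i * ln (a i / b i)) - sum a I * ln c"
    by (simp add: sum_subtractf sum_distrib_left sum_distrib_right)
  then show ?thesis using c by (simp add: c_def)
qed

lemma pmf_bind_finite:
  assumes "finite S" "set_pmf \<mu> \<subseteq> S"
  shows "pmf (bind_pmf \<mu> P) y = (\<Sum>x\<in>S. pmf \<mu> x * pmf (P x) y)"
  using assms by (subst pmf_bind, subst integral_measure_pmf[of S]) auto

text \<open>Gibbs' inequality: both total masses are 1, so the log-sum lower bound is 1 * ln 1 =
  0.\<close>

lemma KL_div_nonneg:
  assumes "finite S" "set_pmf \<mu> \<subseteq> S" "set_pmf \<pi> = S"
  shows "0 \<le> KL_div S \<mu> \<pi>"
proof -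
  have "sum (pmf \<mu>) S = 1" "sum (pmf \<pi>) S = 1"
    using assms by (simp_all add: sum_pmf_eq_1)
  moreover have "pmf \<pi> x \<noteq> 0" if "x \<in> S" for x
    using that assms by (auto simp: set_pmf_iff)
  ultimately show ?thesis
    using log_sum_inequality[of S "pmf \<mu>" "pmf \<pi>"] assms by (simp add: KL_div_def)
qed

text \<open>Data processing: for each target y, the log-sum inequality is applied to the joint
  masses mu(x) P(x,y) and pi(x) P(x,y); stationarity makes the latter sum to pi(y).\<close>

lemma KL_div_bind_le:
  assumes "finite S" "set_pmf \<mu> \<subseteq> S" "set_pmf \<pi> = S"
    and P: "\<And>x. x \<in> S \<Longrightarrow> set_pmf (P x) \<subseteq> S" and "stationary P \<pi>"
  shows "KL_div S (bind_pmf \<mu> P) \<pi> \<le> KL_div S \<mu> \<pi>"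
proof -
  have pos: "0 < pmf \<pi> x" if "x \<in> S" for x
    using that assms(3) by (simp add: pmf_positive)
  have "KL_div S (bind_pmf \<mu> P) \<pi>
      \<le> (\<Sum>y\<in>S. \<Sum>x\<in>S. pmf \<mu> x * pmf (P x) y * ln (pmf \<mu> x / pmf \<pi> x))"
    unfolding KL_div_def
  proof (rule sum_mono)
    fix y assume "y \<in> S"
    have \<pi>y: "pmf \<pi> y = (\<Sum>x\<in>S. pmf \<pi> x * pmf (P x) y)"
      using pmf_bind_finite[of S \<pi> P y] assms by (simp add: stationary_def)
    have "pmf (bind_pmf \<mu> P) y * ln (pmf (bind_pmf \<mu> P) y / pmf \<pi> y)
        \<le> (\<Sum>x\<in>S. pmf \<mu> x * pmf (P x) y *
              ln (pmf \<mu> x * pmf (P x) y / (pmf \<pi> x * pmf (P x) y)))"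
      unfolding pmf_bind_finite[OF assms(1,2)] \<pi>y
      using assms(1) pos by (intro log_sum_inequality) (auto simp: less_le)
    \<comment> \<open>P(x,y) cancels in the quotient unless it is 0, and then the prefactor kills
      the term.\<close>
    also have "\<dots> = (\<Sum>x\<in>S. pmf \<mu> x * pmf (P x) y * ln (pmf \<mu> x / pmf \<pi> x))"
      by (intro sum.cong refl) auto
    finally show "pmf (bind_pmf \<mu> P) y * ln (pmf (bind_pmf \<mu> P) y / pmf \<pi> y)
        \<le> (\<Sum>x\<in>S. pmf \<mu> x * pmf (P x) y * ln (pmf \<mu> x / pmf \<pi> x))" .
  qed
  \<comment> \<open>Exchanging the sums isolates the row sums, which are 1.\<close>
  also have "\<dots> = (\<Sum>x\<in>S. (\<Sum>y\<in>S. pmf (P x) y) * (pmf \<mu> x * ln (pmf \<mu> x / pmf \<pi> x)))"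
    by (subst sum.swap) (simp add: sum_distrib_left sum_distrib_right mult_ac)
  also have "\<dots> = KL_div S \<mu> \<pi>"
    using assms(1) P by (simp add: KL_div_def sum_pmf_eq_1)
  finally show ?thesis .
qed

text \<open>Data processing caps every ratio at 1, and the invariant law attains the cap. Its
  nonzero divergence keeps the ratio from being 0 / 0 = 0.\<close>

lemma eta_KL_eq_1I:
  assumes chain: "reversible_chain S P \<pi>"
    and \<mu>: "\<mu> \<in> dists_on S" "\<mu> \<noteq> \<pi>" "bind_pmf \<mu> P = \<mu>" "KL_div S \<mu> \<pi> \<noteq> 0"
  shows "eta_KL S P \<pi> = 1"
  unfolding eta_KL_def
proof (rule cSup_eq_maximum)
  show "1 \<in> (\<lambda>\<mu>. KL_div S (bind_pmf \<mu> P) \<pi> / KL_div S \<mu> \<pi>) ` (dists_on S - {\<pi>})"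
    using \<mu> by (intro rev_image_eqI[of \<mu>]) auto
next
  fix t assume "t \<in> (\<lambda>\<mu>. KL_div S (bind_pmf \<mu> P) \<pi> / KL_div S \<mu> \<pi>) ` (dists_on S - {\<pi>})"
  then obtain \<nu> where \<nu>: "\<nu> \<in> dists_on S" "t = KL_div S (bind_pmf \<nu> P) \<pi> / KL_div S \<nu> \<pi>"
    by auto
  have "0 \<le> KL_div S \<nu> \<pi>" "KL_div S (bind_pmf \<nu> P) \<pi> \<le> KL_div S \<nu> \<pi>"
    using chain \<nu> by (auto simp: reversible_chain_def markov_kernel_def dists_on_def
        intro!: KL_div_nonneg KL_div_bind_le)
  \<comment> \<open>If \<open>KL_div S \<nu> \<pi>\<close> is 0, the quotient is 0 by HOL's
    convention for division.\<close>
  then show "t \<le> 1"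
    using \<nu> by (auto simp: divide_le_eq_1)
qed

text \<open>Summing detailed balance over x leaves pi(y) times a full row sum; off \<open>S\<close>
  both masses vanish.\<close>

lemma stationary_if_reversible:
  assumes "finite S" "set_pmf \<pi> = S" "\<And>x. x \<in> S \<Longrightarrow> set_pmf (P x) \<subseteq> S" "reversible S P \<pi>"
  shows "stationary P \<pi>"
  unfolding stationary_def
proof (rule pmf_eqI)
  fix y
  show "pmf (bind_pmf \<pi> P) y = pmf \<pi> y"
  proof (cases "y \<in> S")
    case True
    have "pmf (bind_pmf \<pi> P) y = (\<Sum>x\<in>S. pmf \<pi> x * pmf (P x) y)"
      using assms by (simp add: pmf_bind_finite)
    also have "\<dots> = (\<Sum>x\<in>S. pmf \<pi> y * pmf (P y) x)"
      using assms True by (intro sum.cong refl) (auto simp: reversible_def)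
    also have "\<dots> = pmf \<pi> y"
      using assms True by (simp add: sum_distrib_left[symmetric] sum_pmf_eq_1)
    finally show ?thesis .
  next
    case False
    then have "y \<notin> set_pmf (bind_pmf \<pi> P)" "y \<notin> set_pmf \<pi>"
      using assms by auto
    then show ?thesis by (metis pmf_eq_0_set_pmf)
  qed
qed

text \<open>The density of one law against the other is constant on \<open>C\<close>. This serves
  both for the rows of the block chain and for its invariant law on the small block.\<close>

lemma KL_div_uniform_uniform:
  assumes "finite S" "C \<subseteq> S" "C \<noteq> {}"
  shows "KL_div S (pmf_of_set C) (pmf_of_set S) = ln (card S / card C)"
proof -
  have C: "finite C" "card C > 0" and S: "S \<noteq> {}"
    using assms by (auto simp: finite_subset card_gt_0_iff)
  have "KL_div S (pmf_of_set C) (pmf_of_set S)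
      = (\<Sum>x\<in>C. pmf (pmf_of_set C) x * ln (pmf (pmf_of_set C) x / pmf (pmf_of_set S) x))"
    unfolding KL_div_def using assms C by (intro sum.mono_neutral_right) auto
  also have "\<dots> = (\<Sum>x\<in>C. 1 / card C * ln (card S / card C))"
    using assms C S by (intro sum.cong refl) auto
  also have "\<dots> = ln (card S / card C)"
    using C by simp
  finally show ?thesis .
qed

section \<open>The two-block chain and its coefficients\<close>

definition block :: "nat \<Rightarrow> nat \<Rightarrow> nat set" where
  "block n x = (if x < n then {..<n} else {n..<n * n})"

definition block_kernel :: "nat \<Rightarrow> nat \<Rightarrow> nat pmf" where
  "block_kernel n x = pmf_of_set (block n x)"

text \<open>The common value of r(x) on the large block of n^2 - n states: row divergence over ln(1
  / pi(x)) = ln(n^2).\<close>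

definition large_retention :: "nat \<Rightarrow> real" where
  "large_retention n = ln (real (n * n) / real (n * n - n)) / ln (real (n * n))"

context
  fixes n :: nat
  assumes n: "2 \<le> n"
begin

text \<open>Ensures that both blocks are nonempty.\<close>

lemma less_square: "n < n * n"
  using n by simp

lemma grid_uniform:
  "set_pmf (pmf_of_set {..<n * n}) = {..<n * n}"
  "x < n * n \<Longrightarrow> pmf (pmf_of_set {..<n * n}) x = 1 / real (n * n)"
proof -
  have "{..<n * n} \<noteq> {}"
    using n by (simp add: lessThan_empty_iff)
  note [simp] = set_pmf_of_set[OF this finite_lessThan] pmf_of_set[OF this finite_lessThan]
  show "set_pmf (pmf_of_set {..<n * n}) = {..<n * n}"
    by simp
  show "pmf (pmf_of_set {..<n * n}) x = 1 / real (n * n)" if "x < n * n"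
    using that by simp
qed

lemma block_properties:
  assumes "x < n * n"
  shows "finite (block n x)" "block n x \<noteq> {}" "block n x \<subseteq> {..<n * n}"
  using assms less_square by (auto simp: block_def)

lemma reversible_chain_block:
  "reversible_chain {..<n * n} (block_kernel n) (pmf_of_set {..<n * n})"
proof -
  have supp: "set_pmf (block_kernel n x) \<subseteq> {..<n * n}" if "x \<in> {..<n * n}" for x
    using block_properties[of x] that by (simp add: block_kernel_def)
  have "reversible {..<n * n} (block_kernel n) (pmf_of_set {..<n * n})"
    unfolding reversible_def
  proof (intro ballI)
    fix x y assume xy: "x \<in> {..<n * n}" "y \<in> {..<n * n}"
    \<comment> \<open>States of one block share the same uniform row; for states of different blocks
      both sides are 0. With a uniform law this symmetry is detailed balance.\<close>
    have "pmf (block_kernel n x) y = pmf (block_kernel n y) x"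
      using block_properties[of x] block_properties[of y] xy
      by (simp add: block_kernel_def) (auto simp: block_def)
    then show "pmf (pmf_of_set {..<n * n}) x * pmf (block_kernel n x) y
        = pmf (pmf_of_set {..<n * n}) y * pmf (block_kernel n y) x"
      using xy by (simp add: grid_uniform)
  qed
  moreover have "2 \<le> n * n"
    using n less_square by linarith
  ultimately show ?thesis
    using supp
    by (auto simp: grid_uniform reversible_chain_def markov_kernel_def dists_on_def
        intro!: stationary_if_reversible[of "{..<n * n}"])
qed

lemma retention_block:
  assumes "x < n * n"
  shows "retention {..<n * n} (block_kernel n) (pmf_of_set {..<n * n}) x
    = (if x < n then 1 / 2 else large_retention n)"
proof -
  have "retention {..<n * n} (block_kernel n) (pmf_of_set {..<n * n}) x
      = ln (real (n * n) / card (block n x)) / ln (real (n * n))"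
    using assms block_properties[OF assms]
    by (simp add: retention_def block_kernel_def KL_div_uniform_uniform grid_uniform)
  \<comment> \<open>On the small block the quotient is ln n / ln(n^2), and ln(n^2) = 2 ln n.\<close>
  also have "\<dots> = (if x < n then 1 / 2 else large_retention n)"
    using n by (auto simp: block_def large_retention_def ln_mult)
  finally show ?thesis .
qed

text \<open>For n \<ge> 2 the large block has at least n states, so its rows are no farther from
  uniform than those of the small block. Hence the maximum sits on the small block.\<close>

lemma large_retention_le_half: "large_retention n \<le> 1 / 2"
proof -
  have nn: "n + n \<le> n * n"
    using n by (metis mult_2 mult_le_mono1)
  then have "real (n * n) / real (n * n - n) \<le> real (n * n) / real n"
    using n less_square by (intro divide_left_mono) auto
  then have "ln (real (n * n) / real (n * n - n)) \<le> ln (real n)"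
    using n less_square by (subst ln_le_cancel_iff) auto
  moreover have "ln (real (n * n)) = 2 * ln (real n)" "0 < ln (real n)"
    using n by (simp_all add: ln_mult)
  ultimately show ?thesis
    by (simp add: large_retention_def field_simps)
qed

lemma max_retention_block:
  "max_retention {..<n * n} (block_kernel n) (pmf_of_set {..<n * n}) = 1 / 2"
  unfolding max_retention_def
proof (rule Max_eqI)
  show "1 / 2 \<in> retention {..<n * n} (block_kernel n) (pmf_of_set {..<n * n}) ` {..<n * n}"
    using n less_square by (intro rev_image_eqI[of 0]) (auto simp: retention_block)
qed (use large_retention_le_half in \<open>auto simp: retention_block\<close>)

lemma mean_retention_block:
  "mean_retention {..<n * n} (block_kernel n) (pmf_of_set {..<n * n})
    = 1 / (2 * real n) + (1 - 1 / real n) * large_retention n"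
proof -
  have "mean_retention {..<n * n} (block_kernel n) (pmf_of_set {..<n * n})
      = (\<Sum>x<n * n. (if x < n then 1 / 2 else large_retention n) / real (n * n))"
    unfolding mean_retention_def
    by (intro sum.cong refl) (auto simp: retention_block grid_uniform)
  \<comment> \<open>Splitting at n: the small block has mass n / n^2 = 1 / n.\<close>
  also have "\<dots> = (\<Sum>x<n. 1 / 2 / real (n * n)) + (\<Sum>x\<in>{n..<n * n}. large_retention n / real (n * n))"
    unfolding ivl_disj_un_one(2)[OF less_imp_le[OF less_square], symmetric]
    by (subst sum.union_disjoint) (auto intro!: arg_cong2[of _ _ _ _ "(+)"] sum.cong)
  also have "\<dots> = 1 / (2 * real n) + (1 - 1 / real n) * large_retention n"
    using n less_square by (simp add: of_nat_diff field_simps)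
  finally show ?thesis .
qed

text \<open>Dividing by M = 1/2 doubles the mean; M being nonzero rules out the 0/0
  convention.\<close>

lemma localization_ratio_block:
  "localization_ratio {..<n * n} (block_kernel n) (pmf_of_set {..<n * n})
    = 1 / real n + 2 * (1 - 1 / real n) * large_retention n"
  by (simp add: localization_ratio_def max_retention_block mean_retention_block algebra_simps)

lemma eta_KL_block:
  "eta_KL {..<n * n} (block_kernel n) (pmf_of_set {..<n * n}) = 1"
proof (rule eta_KL_eq_1I[OF reversible_chain_block])
  let ?\<mu> = "pmf_of_set {..<n}"
  have ne: "{..<n} \<noteq> {}" "{..<n * n} \<noteq> {}" and sub: "{..<n} \<subseteq> {..<n * n}"
    using n less_square by (auto simp: lessThan_empty_iff)
  show "?\<mu> \<in> dists_on {..<n * n}"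
    using ne sub by (simp add: dists_on_def)
  \<comment> \<open>Every row started in the small block is \<open>?\<mu>\<close> itself.\<close>
  have "bind_pmf ?\<mu> (block_kernel n) = bind_pmf ?\<mu> (\<lambda>_. ?\<mu>)"
    using ne by (intro bind_pmf_cong) (auto simp: block_kernel_def block_def)
  then show "bind_pmf ?\<mu> (block_kernel n) = ?\<mu>" by simp
  show "?\<mu> \<noteq> pmf_of_set {..<n * n}"
  proof
    assume "?\<mu> = pmf_of_set {..<n * n}"
    from arg_cong[OF this, of set_pmf] have "{..<n} = {..<n * n}"
      using ne by simp
    then show False using less_square by simp
  qed
  \<comment> \<open>The divergence is ln(n^2 / n) = ln n, positive as n \<ge> 2.\<close>
  show "KL_div {..<n * n} ?\<mu> (pmf_of_set {..<n * n}) \<noteq> 0"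
    using n by (simp add: KL_div_uniform_uniform[OF _ sub] ne)
qed

end

section \<open>Limits and assembly\<close>

text \<open>Both terms vanish: the first is 1/n, and \<open>large_retention n\<close> behaves like 1
  / (2 n ln n).\<close>

lemma localization_ratio_block_tendsto:
  "(\<lambda>N. localization_ratio {..<(N + 2) * (N + 2)} (block_kernel (N + 2))
          (pmf_of_set {..<(N + 2) * (N + 2)})) \<longlonglongrightarrow> 0"
proof -
  have "(\<lambda>n. 1 / real n + 2 * (1 - 1 / real n) *
      (ln (real n * real n / (real n * real n - real n)) / ln (real n * real n))) \<longlonglongrightarrow> 0"
    by real_asymp
  then have "(\<lambda>n. 1 / real n + 2 * (1 - 1 / real n) * large_retention n) \<longlonglongrightarrow> 0"
    \<comment> \<open>The natural subtraction in \<open>large_retention\<close> is exact because n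
      \<le> n * n.\<close>
    by (simp add: large_retention_def of_nat_diff)
  from LIMSEQ_ignore_initial_segment[OF this, of 2] show ?thesis
    by (subst localization_ratio_block) auto
qed

theorem theoremD1:
  "(\<forall>\<epsilon>::real. 0 < \<epsilon> \<and> \<epsilon> < 1/2 \<longrightarrow>
      (\<exists>(S :: real \<Rightarrow> nat \<Rightarrow> nat set) (P :: real \<Rightarrow> nat \<Rightarrow> nat \<Rightarrow> nat pmf)
         (\<pi> :: real \<Rightarrow> nat \<Rightarrow> nat pmf).
         (\<forall>\<delta> N. 0 < \<delta> \<and> \<delta> < 1 \<and> 1 \<le> N \<longrightarrow>
            reversible_chain (S \<delta> N) (P \<delta> N) (\<pi> \<delta> N) \<and>
            max_retention (S \<delta> N) (P \<delta> N) (\<pi> \<delta> N) > 0) \<and>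
         (\<exists>l. has_iterated_limit
                (\<lambda>\<delta> N. localization_ratio (S \<delta> N) (P \<delta> N) (\<pi> \<delta> N)) l \<and> l \<le> 2 * \<epsilon>) \<and>
         (\<exists>l. has_iterated_limit
                (\<lambda>\<delta> N. eta_KL (S \<delta> N) (P \<delta> N) (\<pi> \<delta> N)
                        / max_retention (S \<delta> N) (P \<delta> N) (\<pi> \<delta> N)) l \<and> l \<ge> 2)))
   \<and>
   (\<exists>(S :: nat \<Rightarrow> nat set) (P :: nat \<Rightarrow> nat \<Rightarrow> nat pmf) (\<pi> :: nat \<Rightarrow> nat pmf).
      (\<forall>n. reversible_chain (S n) (P n) (\<pi> n) \<and>
           max_retention (S n) (P n) (\<pi> n) > 0) \<and>
      (\<lambda>n. localization_ratio (S n) (P n) (\<pi> n)) \<longlonglongrightarrow> 0 \<and>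
      \<not> ((\<lambda>n. eta_KL (S n) (P n) (\<pi> n) / max_retention (S n) (P n) (\<pi> n)) \<longlonglongrightarrow> 1))"
proof -
  \<comment> \<open>The shift by 2 gives n \<ge> 2 for every index, including N = 0 in the
    sequential claim.\<close>
  define S where "S = (\<lambda>N::nat. {..<(N + 2) * (N + 2)})"
  define P where "P = (\<lambda>N::nat. block_kernel (N + 2))"
  define \<pi> where "\<pi> = (\<lambda>N. pmf_of_set (S N))"
  have chain: "reversible_chain (S N) (P N) (\<pi> N)" for N
    unfolding S_def P_def \<pi>_def by (rule reversible_chain_block) simp
  have M: "max_retention (S N) (P N) (\<pi> N) = 1 / 2" for N
    unfolding S_def P_def \<pi>_def by (rule max_retention_block) simp
  have eta: "eta_KL (S N) (P N) (\<pi> N) = 1" for N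
    unfolding S_def P_def \<pi>_def by (rule eta_KL_block) simp
  have L: "(\<lambda>N. localization_ratio (S N) (P N) (\<pi> N)) \<longlonglongrightarrow> 0"
    unfolding S_def P_def \<pi>_def by (rule localization_ratio_block_tendsto)
  \<comment> \<open>Without dependence on \<delta>, the inner limit at N is f N itself.\<close>
  have const: "has_iterated_limit (\<lambda>\<delta>. f) l" if "f \<longlonglongrightarrow> l" for f l
    using that by (auto simp: has_iterated_limit_def)
  have ratio: "(\<lambda>N. eta_KL (S N) (P N) (\<pi> N) / max_retention (S N) (P N) (\<pi> N)) = (\<lambda>N. 2)"
    by (simp add: eta M)
  show ?thesis
  proof (intro conjI allI impI)
    fix \<epsilon> :: real assume "0 < \<epsilon> \<and> \<epsilon> < 1 / 2"
    \<comment> \<open>The localization limit is 0, so this is the bound required of it.\<close>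
    then have "0 \<le> 2 * \<epsilon>" by simp
    moreover have "has_iterated_limit
        (\<lambda>\<delta> N. eta_KL (S N) (P N) (\<pi> N) / max_retention (S N) (P N) (\<pi> N)) 2"
      by (rule const) (simp add: ratio)
    ultimately show "\<exists>(S :: real \<Rightarrow> nat \<Rightarrow> nat set) (P :: real \<Rightarrow> nat \<Rightarrow> nat \<Rightarrow> nat pmf)
         (\<pi> :: real \<Rightarrow> nat \<Rightarrow> nat pmf).
         (\<forall>\<delta> N. 0 < \<delta> \<and> \<delta> < 1 \<and> 1 \<le> N \<longrightarrow>
            reversible_chain (S \<delta> N) (P \<delta> N) (\<pi> \<delta> N) \<and>
            max_retention (S \<delta> N) (P \<delta> N) (\<pi> \<delta> N) > 0) \<and>
         (\<exists>l. has_iterated_limit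
                (\<lambda>\<delta> N. localization_ratio (S \<delta> N) (P \<delta> N) (\<pi> \<delta> N)) l \<and> l \<le> 2 * \<epsilon>) \<and>
         (\<exists>l. has_iterated_limit
                (\<lambda>\<delta> N. eta_KL (S \<delta> N) (P \<delta> N) (\<pi> \<delta> N)
                        / max_retention (S \<delta> N) (P \<delta> N) (\<pi> \<delta> N)) l \<and> l \<ge> 2)"
      using chain const[OF L]
      by (intro exI[of _ "\<lambda>\<delta>. S"] exI[of _ "\<lambda>\<delta>. P"] exI[of _ "\<lambda>\<delta>. \<pi>"]) (auto simp: M)
  next
    \<comment> \<open>The ratio is the constant sequence 2, whose only limit is 2.\<close>
    have "\<not> (\<lambda>N. eta_KL (S N) (P N) (\<pi> N) / max_retention (S N) (P N) (\<pi> N)) \<longlonglongrightarrow> 1"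
      by (simp add: ratio LIMSEQ_const_iff)
    then show "\<exists>(S :: nat \<Rightarrow> nat set) (P :: nat \<Rightarrow> nat \<Rightarrow> nat pmf) (\<pi> :: nat \<Rightarrow> nat pmf).
      (\<forall>n. reversible_chain (S n) (P n) (\<pi> n) \<and>
           max_retention (S n) (P n) (\<pi> n) > 0) \<and>
      (\<lambda>n. localization_ratio (S n) (P n) (\<pi> n)) \<longlonglongrightarrow> 0 \<and>
      \<not> ((\<lambda>n. eta_KL (S n) (P n) (\<pi> n) / max_retention (S n) (P n) (\<pi> n)) \<longlonglongrightarrow> 1)"
      using chain L by (intro exI[of _ S] exI[of _ P] exI[of _ \<pi>]) (auto simp: M)
  qed
qed

end
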